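(* Let $F:\Omega\to\mathbb{R}^m$ be a mapping, where $\Omega\subset\mathbb{R}^n$ is open. Then the following two statements are equivalent: 1. $F$ is semismooth on $\Omega$ with respect to some mapping $\Psi:\mathbb{R}^n\rightrightarrows\mathbb{R}^{m\times n}$. 2. $F$ is locally Lipschitz on $\Omega$ and semismooth on $\Omega$ with respect to the mapping $x\mapsto\mathrm{conv}\,\overline{\nabla}F(x)$, $x\in\Omega$ (i.e., $F$ is G-semismooth on $\Omega$). Moreover, these statements entail that $F$ is strictly differentiable on $\Omega$ up to a set of Lebesgue measure zero.
   Context: A multifunction $\Psi:\mathbb{R}^n\rightrightarrows\mathbb{R}^{m\times n}$ assigns to each $x$ a (possibly empty) set of $m\times n$ matrices; $\mathrm{dom}\,\Psi=\{x : \Psi(x)\neq\emptyset\}$. $\Psi$ is locally bounded at $\bar x$ if there are a neighborhood $U$ of $\bar x$ and $M\ge 0$ with $\|A\|\le M$ for all $A\in\Psi(x)$, $x\in U$. Let $F:\Omega\to\mathbb{R}^m$ with $\Omega\subset\mathbb{R}^n$ open. $F$ is semismooth with respect to $\Psi$ at $\bar x\in\Omega$ if $\mathrm{dom}\,\Psi$ is a neighborhood of $\bar x$, $\Psi$ is locally bounded at $\bar x$, and $$\lim_{x\to\bar x,\ x\in\Omega,\ x\ne\bar x}\frac{\sup\{\|F(x)-F(\bar x)-A(x-\bar x)\| : A\in\Psi(x)\}}{\|x-\bar x\|}=0.$$ $F$ is semismooth on $\Omega$ with respect to $\Psi$ if this holds at every $\bar x\in\Omega$. No continuity of $F$ is assumed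 a priori. $\mathcal{O}_F$ is the set of points of $\Omega$ where $F$ is Fréchet differentiable, $\nabla F(x)\in\mathbb{R}^{m\times n}$ is the Jacobian. The B-Jacobian is $\overline{\nabla}F(\bar x)=\{A : A=\lim_k\nabla F(x_k)\text{ for some sequence }x_k\to\bar x,\ x_k\in\mathcal{O}_F\}$; $\mathrm{conv}$ denotes the convex hull. $F$ is strictly differentiable at $\bar x\in\Omega$ if $F$ is Lipschitz near $\bar x$ and there is an $m\times n$ matrix $A$ such that $\lim_{x\to\bar x,\,t\downarrow0}\frac{F(x+tu)-F(x)}{t}=Au$ for all $u\in\mathbb{R}^n$. *)

theory Defs
  imports "HOL-Analysis.Analysis"
begin

text \<open>
  A multifunction from R^n to the m-by-n matrices is a set-valued function
  \<open>\<Psi> :: real^'n \<Rightarrow> (real^'n^'m) set\<close>. A map F on an open set \<open>\<Omega>\<close> is a total function; every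
  notion below depends only on the values of F on \<open>\<Omega>\<close> when \<open>\<Omega>\<close> is open.
\<close>

definition mdom :: "(real^'n \<Rightarrow> (real^'n^'m) set) \<Rightarrow> (real^'n) set" where
  "mdom \<Psi> = {x. \<Psi> x \<noteq> {}}"

text \<open>
  The matrix norm is the library (Frobenius) norm; all norms on this finite-dimensional space
  give the same notion.
\<close>

definition locally_bounded_at :: "(real^'n \<Rightarrow> (real^'n^'m) set) \<Rightarrow> real^'n \<Rightarrow> bool" where
  "locally_bounded_at \<Psi> x0 \<longleftrightarrow>
     (\<exists>U M. open U \<and> x0 \<in> U \<and> M \<ge> 0 \<and> (\<forall>x\<in>U. \<forall>A\<in>\<Psi> x. norm A \<le> M))"

text \<open>
  The first two conjuncts make the set under the supremum nonempty and bounded for all x in a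
  neighbourhood of \<open>x0\<close>, so the limit only involves genuine real suprema.
\<close>

definition semismooth_at ::
  "(real^'n) set \<Rightarrow> (real^'n \<Rightarrow> real^'m) \<Rightarrow> (real^'n \<Rightarrow> (real^'n^'m) set) \<Rightarrow> real^'n \<Rightarrow> bool" where
  "semismooth_at \<Omega> F \<Psi> x0 \<longleftrightarrow>
     x0 \<in> interior (mdom \<Psi>) \<and>
     locally_bounded_at \<Psi> x0 \<and>
     ((\<lambda>x. (SUP A\<in>\<Psi> x. norm (F x - F x0 - A *v (x - x0))) / norm (x - x0)) \<longlongrightarrow> 0)
       (at x0 within \<Omega>)"

definition semismooth_on ::
  "(real^'n) set \<Rightarrow> (real^'n \<Rightarrow> real^'m) \<Rightarrow> (real^'n \<Rightarrow> (real^'n^'m) set) \<Rightarrow> bool" where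
  "semismooth_on \<Omega> F \<Psi> \<longleftrightarrow> (\<forall>x0\<in>\<Omega>. semismooth_at \<Omega> F \<Psi> x0)"

definition diff_points :: "(real^'n) set \<Rightarrow> (real^'n \<Rightarrow> real^'m) \<Rightarrow> (real^'n) set" where
  "diff_points \<Omega> F = {x \<in> \<Omega>. F differentiable (at x)}"

definition B_jacobian ::
  "(real^'n) set \<Rightarrow> (real^'n \<Rightarrow> real^'m) \<Rightarrow> real^'n \<Rightarrow> (real^'n^'m) set" where
  "B_jacobian \<Omega> F x0 =
     {A. \<exists>X. (\<forall>k. X k \<in> diff_points \<Omega> F) \<and> X \<longlonglongrightarrow> x0 \<and>
             (\<lambda>k. jacobian F (at (X k))) \<longlonglongrightarrow> A}"

text \<open>
  The multifunction is only specified on \<open>\<Omega>\<close>, hence has empty values elsewhere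
  (the B-Jacobian itself may be nonempty at boundary points of \<open>\<Omega>\<close>).
\<close>

definition conv_B_jacobian ::
  "(real^'n) set \<Rightarrow> (real^'n \<Rightarrow> real^'m) \<Rightarrow> real^'n \<Rightarrow> (real^'n^'m) set" where
  "conv_B_jacobian \<Omega> F x = (if x \<in> \<Omega> then convex hull (B_jacobian \<Omega> F x) else {})"

definition lipschitz_near :: "(real^'n) set \<Rightarrow> (real^'n \<Rightarrow> real^'m) \<Rightarrow> real^'n \<Rightarrow> bool" where
  "lipschitz_near \<Omega> F x0 \<longleftrightarrow>
     (\<exists>U L. open U \<and> x0 \<in> U \<and> U \<subseteq> \<Omega> \<and> L-lipschitz_on U F)"

definition locally_lipschitz_on :: "(real^'n) set \<Rightarrow> (real^'n \<Rightarrow> real^'m) \<Rightarrow> bool" where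
  "locally_lipschitz_on \<Omega> F \<longleftrightarrow> (\<forall>x0\<in>\<Omega>. lipschitz_near \<Omega> F x0)"

text \<open>In the limit below, the base point may coincide with \<open>x0\<close>.\<close>

definition strictly_differentiable_at ::
  "(real^'n) set \<Rightarrow> (real^'n \<Rightarrow> real^'m) \<Rightarrow> real^'n \<Rightarrow> bool" where
  "strictly_differentiable_at \<Omega> F x0 \<longleftrightarrow>
     lipschitz_near \<Omega> F x0 \<and>
     (\<exists>A :: real^'n^'m. \<forall>u.
        ((\<lambda>(x, t :: real). (F (x + t *\<^sub>R u) - F x) /\<^sub>R t) \<longlongrightarrow> A *v u)
          (nhds x0 \<times>\<^sub>F at_right 0))"

end

theory Submission
  imports Defs
begin

text \<open>
  The matrices in \<open>\<Psi>\<close> are bounded near a point, so the pointwise estimate of semismoothness bounds all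
  local slopes of \<open>F\<close>, and \<open>F\<close> is Lipschitz on balls.

  For the almost everywhere statement, fix \<open>\<epsilon>\<close> and a selection \<open>A\<close> of \<open>\<Psi>\<close>, and split \<open>\<Omega>\<close> into countably
  many sets on which the semismoothness estimate holds with constant \<open>\<epsilon>\<close> at a uniform scale and \<open>A\<close> is
  \<open>\<epsilon>\<close>-close to a fixed matrix. Such a set \<open>T\<close> is porous only on a null subset. At any other point \<open>x0\<close>
  of \<open>T\<close>, each \<open>x\<close> near \<open>x0\<close> sees points of \<open>T\<close> in all directions at distance about \<open>|x - x0|\<close>, which
  forces every \<open>B \<in> \<Psi> x\<close> to be close to \<open>A x0\<close>. Applied to \<open>F - A x0\<close>, the slope bound then yields strict
  differentiability at almost every \<open>x0\<close>. No measurability is involved, and Rademacher's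
  theorem is not needed.

  Finally, at a point \<open>x \<noteq> x0\<close> of differentiability, the Jacobian agrees in the direction \<open>x - x0\<close> with
  limits of matrices from \<open>\<Psi>\<close> along the ray beyond \<open>x\<close>, so it satisfies the same estimate at \<open>x0\<close>; the
  estimate passes to limits and to convex combinations.
\<close>

subsection \<open>Porosity\<close>

text \<open>Vitali's theorem picks disjoint balls of radius \<open>3 * r\<close> that cover
  \<open>T\<close> up to a null set. Their holes fill a fixed fraction of them, yet lie in a
  neighbourhood of the closure of \<open>T\<close> minus that closure, a set of tiny
  measure.\<close>

lemma negligible_bounded_porous:
  fixes T :: "'a::euclidean_space set"
  assumes "bounded T"
    and porous: "\<And>x d. x \<in> T \<Longrightarrow> d > 0 \<Longrightarrow>
      \<exists>r y. 0 < r \<and> r < d \<and> dist x y \<le> 2 * r \<and> T \<inter> ball y (r/4) = {}"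
  shows "negligible T"
  unfolding negligible_outer_le
proof (intro allI impI)
  fix e :: real assume "e > 0"
  \<comment> \<open>The factor is the volume ratio of \<open>ball x (3 * r)\<close> to a hole of
    radius \<open>r/4\<close>, since 3 / (1/4) = 12.\<close>
  define \<eta> where "\<eta> = e / 12 ^ DIM('a)"
  have "\<eta> > 0" using \<open>e > 0\<close> by (simp add: \<eta>_def)
  let ?K = "closure T"
  have "?K \<in> sets lebesgue"
    by (simp add: borel_closed)
  then obtain U where U: "open U" "?K \<subseteq> U" "U - ?K \<in> lmeasurable"
      "emeasure lebesgue (U - ?K) < ennreal \<eta>"
    using sets_lebesgue_outer_open[OF _ \<open>\<eta> > 0\<close>] by blast
  then have U\<eta>: "measure lebesgue (U - ?K) < \<eta>"
    using \<open>\<eta> > 0\<close> by (simp add: emeasure_eq_measure2 ennreal_less_iff)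
  define I where "I = {(x, r). x \<in> T \<and> 0 < r \<and> ball x (3 * r) \<subseteq> U \<and>
    (\<exists>y. dist x y \<le> 2 * r \<and> T \<inter> ball y (r/4) = {})}"
  define h where "h i = (SOME y. dist (fst i) y \<le> 2 * snd i \<and> T \<inter> ball y (snd i / 4) = {})"
    for i :: "'a \<times> real"
  have h: "dist (fst i) (h i) \<le> 2 * snd i" "T \<inter> ball (h i) (snd i / 4) = {}" if "i \<in> I" for i
    using that someI_ex[of "\<lambda>y. dist (fst i) y \<le> 2 * snd i \<and> T \<inter> ball y (snd i / 4) = {}"]
    by (auto simp: I_def h_def case_prod_beta)
  have hole: "ball (h i) (snd i / 4) \<subseteq> ball (fst i) (3 * snd i)"
             "ball (h i) (snd i / 4) \<subseteq> U - ?K" if "i \<in> I" for i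
  proof -
    have pos: "snd i > 0" and sub: "ball (fst i) (3 * snd i) \<subseteq> U"
      using that by (auto simp: I_def)
    show 1: "ball (h i) (snd i / 4) \<subseteq> ball (fst i) (3 * snd i)"
    proof
      fix z assume "z \<in> ball (h i) (snd i / 4)"
      then show "z \<in> ball (fst i) (3 * snd i)"
        using h(1)[OF that] dist_triangle[of "fst i" z "h i"] pos by simp
    qed
    \<comment> \<open>An open ball that misses \<open>T\<close> also misses its closure, so the
      holes lie in the set of measure below \<eta>.\<close>
    have "?K \<inter> ball (h i) (snd i / 4) = {}"
      using h(2)[OF that] by (metis Int_commute open_Int_closure_eq_empty open_ball)
    then show "ball (h i) (snd i / 4) \<subseteq> U - ?K"
      using 1 sub by auto
  qed
  \<comment> \<open>Vitali's theorem asks for arbitrarily small balls at every point; going below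
    \<open>d'\<close> as well keeps them in \<open>U\<close>.\<close>
  have fine: "\<exists>i. i \<in> I \<and> x \<in> ball (fst i) (3 * snd i) \<and> 3 * snd i < d"
    if "x \<in> T" "d > 0" for x d
  proof -
    obtain d' where d': "d' > 0" "ball x d' \<subseteq> U"
      using U(1,2) \<open>x \<in> T\<close> closure_subset by (meson openE subset_iff)
    obtain r y where "0 < r" "r < min d d' / 3" "dist x y \<le> 2 * r" "T \<inter> ball y (r/4) = {}"
      using porous[OF \<open>x \<in> T\<close>, of "min d d' / 3"] \<open>d > 0\<close> d'(1) by auto
    moreover from this have "ball x (3 * r) \<subseteq> U"
      using d'(2) subset_ball[of "3 * r" d' x] by auto
    ultimately show ?thesis
      using \<open>x \<in> T\<close> by (intro exI[of _ "(x, r)"]) (auto simp: I_def)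
  qed
  obtain C where C: "countable C" "C \<subseteq> I"
     "pairwise (\<lambda>i j. disjnt (ball (fst i) (3 * snd i)) (ball (fst j) (3 * snd j))) C"
     "negligible (T - (\<Union>i\<in>C. ball (fst i) (3 * snd i)))"
    by (rule Vitali_covering_theorem_balls[of T I fst "\<lambda>i. 3 * snd i", OF fine])
  have scale: "measure lebesgue (ball (fst i) (3 * snd i))
      = 12 ^ DIM('a) * measure lebesgue (ball (h i) (snd i / 4))" if "i \<in> I" for i
  proof -
    have "snd i > 0" using that by (auto simp: I_def)
    moreover have "(3 * snd i) ^ DIM('a) = 12 ^ DIM('a) * (snd i / 4) ^ DIM('a)"
      by (subst power_mult_distrib[symmetric]) (rule arg_cong[where f="\<lambda>t. t ^ DIM('a)"], simp)
    ultimately show ?thesis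
      using content_ball_conv_unit_ball[of "3 * snd i" "fst i"]
            content_ball_conv_unit_ball[of "snd i / 4" "h i"] by simp
  qed
  \<comment> \<open>A uniform bound over finite subfamilies carries over to the countable union
    \<open>?B\<close>.\<close>
  have fin: "measure lebesgue (\<Union>i\<in>J. ball (fst i) (3 * snd i)) \<le> e"
    if J: "J \<subseteq> C" "finite J" for J
  proof -
    have JI: "J \<subseteq> I" using J C by auto
    have "measure lebesgue (\<Union>i\<in>J. ball (fst i) (3 * snd i))
        \<le> (\<Sum>i\<in>J. measure lebesgue (ball (fst i) (3 * snd i)))"
      by (rule measure_UNION_le[OF J(2)]) auto
    also have "\<dots> = 12 ^ DIM('a) * (\<Sum>i\<in>J. measure lebesgue (ball (h i) (snd i / 4)))"
      using scale JI by (auto simp: sum_distrib_left intro!: sum.cong)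
    also have "(\<Sum>i\<in>J. measure lebesgue (ball (h i) (snd i / 4)))
        = measure lebesgue (\<Union>i\<in>J. ball (h i) (snd i / 4))"
    proof (rule measure_finite_Union[symmetric, OF J(2)])
      show "disjoint_family_on (\<lambda>i. ball (h i) (snd i / 4)) J"
        unfolding disjoint_family_on_def
      proof (intro ballI impI)
        fix i j assume ij: "i \<in> J" "j \<in> J" "i \<noteq> j"
        then have "ball (fst i) (3 * snd i) \<inter> ball (fst j) (3 * snd j) = {}"
          using C(3) J(1) unfolding pairwise_def disjnt_def by blast
        then show "ball (h i) (snd i / 4) \<inter> ball (h j) (snd j / 4) = {}"
          using hole(1)[of i] hole(1)[of j] ij JI by blast
      qed
    qed (auto simp: less_imp_neq[OF emeasure_lborel_ball_finite, simplified])
    also have "\<dots> \<le> measure lebesgue (U - ?K)"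
      by (rule measure_mono_fmeasurable[OF _ _ U(3)]) (use hole(2) JI J in auto)
    also have "12 ^ DIM('a) * measure lebesgue (U - ?K) \<le> e"
      using U\<eta> unfolding \<eta>_def by (simp add: field_simps)
    finally show ?thesis by simp
  qed
  let ?B = "\<Union>i\<in>C. ball (fst i) (3 * snd i)"
  have B: "?B \<in> lmeasurable" "measure lebesgue ?B \<le> e"
    by (rule fmeasurable_UN_bound[OF C(1) _ fin] measure_UN_bound[OF C(1) _ fin]; simp)+
  let ?N = "T - ?B"
  have "?B \<union> ?N \<in> lmeasurable"
    by (rule fmeasurable.Un[OF B(1) negligible_imp_measurable[OF C(4)]])
  moreover have "measure lebesgue (?B \<union> ?N) = measure lebesgue ?B"
    using measure_Un_null_set[OF fmeasurableD[OF B(1)]] C(4) negligible_iff_null_sets by blast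
  ultimately show "\<exists>V. T \<subseteq> V \<and> V \<in> lmeasurable \<and> measure lebesgue V \<le> e"
    using B(2) by (intro exI[of _ "?B \<union> ?N"]) auto
qed

text \<open>Passing to a subset keeps every hole, so each bounded piece of the set of porosity
  points is porous at all of its own points.\<close>

lemma negligible_porosity_points:
  fixes S :: "'a::euclidean_space set"
  shows "negligible {x \<in> S. \<forall>d>0. \<exists>r y. 0 < r \<and> r < d \<and> dist x y \<le> 2 * r \<and> S \<inter> ball y (r/4) = {}}"
    (is "negligible ?P")
proof -
  have "negligible (?P \<inter> ball 0 (real n))" for n
  proof (rule negligible_bounded_porous)
    show "bounded (?P \<inter> ball 0 (real n))"
      by (simp add: bounded_Int)
    fix x :: 'a and d :: real assume "x \<in> ?P \<inter> ball 0 (real n)" "d > 0"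
    then obtain r y where "0 < r" "r < d" "dist x y \<le> 2 * r" "S \<inter> ball y (r/4) = {}"
      by blast
    then show "\<exists>r y. 0 < r \<and> r < d \<and> dist x y \<le> 2 * r \<and> (?P \<inter> ball 0 (real n)) \<inter> ball y (r/4) = {}"
      by blast
  qed
  then have "negligible (\<Union>n. ?P \<inter> ball 0 (real n))"
    by (rule negligible_Union_nat)
  moreover have "?P \<subseteq> (\<Union>n. ?P \<inter> ball 0 (real n))"
  proof
    fix x assume "x \<in> ?P"
    moreover obtain n where "norm x < real n" using reals_Archimedean2 by blast
    ultimately show "x \<in> (\<Union>n. ?P \<inter> ball 0 (real n))" by auto
  qed
  ultimately show ?thesis
    by (rule negligible_subset)
qed

subsection \<open>Lipschitz estimates from semismoothness\<close>

text \<open>The radius may vary with \<open>x\<close>, so the segment is bisected: the increment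
  bound is additive over parameter intervals and holds on all short intervals around a given
  parameter.\<close>

lemma lipschitz_on_convex_pointwise:
  fixes f :: "'a::real_normed_vector \<Rightarrow> 'b::real_normed_vector"
  assumes "convex U" "K \<ge> 0"
    and loc: "\<And>x. x \<in> U \<Longrightarrow> \<exists>d>0. \<forall>y\<in>U. dist y x < d \<longrightarrow> norm (f y - f x) \<le> K * norm (y - x)"
  shows "K-lipschitz_on U f"
proof (rule lipschitz_onI)
  fix a b assume ab: "a \<in> U" "b \<in> U"
  define p where "p t = a + t *\<^sub>R (b - a)" for t
  have pU: "p t \<in> U" if "0 \<le> t" "t \<le> 1" for t
    using convexD_alt[OF assms(1) ab that] by (simp add: p_def algebra_simps)
  have pdiff: "norm (p s - p t) = \<bar>s - t\<bar> * norm (b - a)" for s t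
    by (simp add: p_def flip: scaleR_left_diff_distrib)
  have "0 \<le> (0::real) \<and> (1::real) \<le> 1 \<longrightarrow> norm (f (p 1) - f (p 0)) \<le> K * ((1 - 0) * norm (b - a))"
  proof (rule Bolzano[where P = "\<lambda>s t. 0 \<le> s \<and> t \<le> 1 \<longrightarrow> norm (f (p t) - f (p s)) \<le> K * ((t - s) * norm (b - a))"])
    fix s t u :: real
    assume "0 \<le> s \<and> t \<le> 1 \<longrightarrow> norm (f (p t) - f (p s)) \<le> K * ((t - s) * norm (b - a))"
      "0 \<le> t \<and> u \<le> 1 \<longrightarrow> norm (f (p u) - f (p t)) \<le> K * ((u - t) * norm (b - a))" "s \<le> t" "t \<le> u"
    then show "0 \<le> s \<and> u \<le> 1 \<longrightarrow> norm (f (p u) - f (p s)) \<le> K * ((u - s) * norm (b - a))"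
      using norm_triangle_ineq[of "f (p u) - f (p t)" "f (p t) - f (p s)"]
      by (auto simp: algebra_simps)
  next
    fix x :: real assume x: "0 \<le> x" "x \<le> 1"
    obtain d where d: "d > 0" "\<And>y. y \<in> U \<Longrightarrow> dist y (p x) < d \<Longrightarrow> norm (f y - f (p x)) \<le> K * norm (y - p x)"
      using loc[OF pU[OF x]] by blast
    define d' where "d' = d / (norm (b - a) + 1)"
    have "d' > 0" using d by (simp add: d'_def add_nonneg_pos)
    have near: "norm (f (p t) - f (p x)) \<le> K * (\<bar>t - x\<bar> * norm (b - a))" if "\<bar>t - x\<bar> < d'" "0 \<le> t" "t \<le> 1" for t
    proof -
      have "\<bar>t - x\<bar> * norm (b - a) \<le> \<bar>t - x\<bar> * (norm (b - a) + 1)"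
        by (simp add: algebra_simps)
      also have "\<dots> < d"
        using that(1) unfolding d'_def by (subst (asm) pos_less_divide_eq) (auto simp: add_nonneg_pos)
      finally show ?thesis
        using d(2)[OF pU[OF that(2,3)]] by (simp add: dist_norm pdiff)
    qed
    show "\<exists>d>0. \<forall>s t. s \<le> x \<and> x \<le> t \<and> t - s < d \<longrightarrow>
       (0 \<le> s \<and> t \<le> 1 \<longrightarrow> norm (f (p t) - f (p s)) \<le> K * ((t - s) * norm (b - a)))"
    proof (intro exI[of _ d'] conjI allI impI)
      fix s t assume st: "s \<le> x \<and> x \<le> t \<and> t - s < d'" "0 \<le> s \<and> t \<le> 1"
      \<comment> \<open>The hypothesis compares only with the value at \<open>p x\<close>, so the
        interval is cut at \<open>x\<close>.\<close>
      have "norm (f (p t) - f (p s)) \<le> norm (f (p t) - f (p x)) + norm (f (p s) - f (p x))"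
        using norm_triangle_ineq4[of "f (p t) - f (p x)" "f (p s) - f (p x)"] by simp
      also have "\<dots> \<le> K * ((t - x) * norm (b - a)) + K * ((x - s) * norm (b - a))"
        using near[of t] near[of s] st x by auto
      finally show "norm (f (p t) - f (p s)) \<le> K * ((t - s) * norm (b - a))"
        by (simp add: algebra_simps)
    qed (use \<open>d' > 0\<close> in auto)
  qed auto
  then show "dist (f a) (f b) \<le> K * dist a b"
    by (simp add: p_def dist_norm norm_minus_commute)
qed (rule assms)

section \<open>Frobenius norm and operator bounds\<close>

lemma norm_matrix_vector_le:
  fixes A :: "real^'n^'m"
  shows "norm (A *v x) \<le> norm A * norm x"
proof -
  have "norm (A *v x) \<le> L2_set (\<lambda>i. norm (A $ i) * norm x) UNIV"
    unfolding norm_vec_def[of "A *v x"]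
    by (rule L2_set_mono) (simp_all add: matrix_vector_mul_component Cauchy_Schwarz_ineq2)
  also have "\<dots> = norm A * norm x"
    by (simp add: L2_set_left_distrib norm_vec_def[of A])
  finally show ?thesis .
qed

text \<open>Jacobians are bounded through their action on vectors, whereas
  \<open>locally_bounded_at\<close> refers to the Frobenius norm. Images of basis vectors bound the
  entries; the size of the constant is immaterial.\<close>

lemma norm_matrix_le_of_apply:
  fixes A :: "real^'n^'m"
  assumes "\<And>v. norm (A *v v) \<le> C * norm v"
  shows "norm A \<le> real CARD('m) * (real CARD('n) * C)"
proof -
  have comp: "\<bar>A $ i $ j\<bar> \<le> C" for i j
    using component_le_norm_cart[of "A *v axis j 1" i] assms[of "axis j 1"]
    by (simp add: matrix_vector_mul_component inner_axis)
  have "norm A \<le> (\<Sum>i\<in>UNIV. norm (A $ i))"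
    by (simp add: norm_vec_def[of A] L2_set_le_sum)
  also have "\<dots> \<le> (\<Sum>i\<in>(UNIV::'m set). \<Sum>j\<in>(UNIV::'n set). C)"
    by (intro sum_mono order_trans[OF norm_le_l1_cart] comp)
  finally show ?thesis by simp
qed

section \<open>Semismoothness as an epsilon-delta estimate\<close>

text \<open>Local boundedness of \<Psi> makes the set under the supremum bounded above, so the real
  supremum dominates each single matrix.\<close>

lemma semismooth_at_estimate:
  assumes "semismooth_at \<Omega> F \<Psi> x0" "e > 0"
  obtains d where "d > 0"
    "\<And>x A. x \<in> \<Omega> \<Longrightarrow> dist x x0 < d \<Longrightarrow> A \<in> \<Psi> x \<Longrightarrow>
      norm (F x - F x0 - A *v (x - x0)) \<le> e * norm (x - x0)"
proof -
  obtain U M where U: "open U" "x0 \<in> U" "\<And>x A. x \<in> U \<Longrightarrow> A \<in> \<Psi> x \<Longrightarrow> norm A \<le> M"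
    using assms(1) unfolding semismooth_at_def locally_bounded_at_def by blast
  obtain d1 where d1: "d1 > 0" "ball x0 d1 \<subseteq> U"
    using U(1,2) openE by blast
  let ?S = "\<lambda>x. SUP A\<in>\<Psi> x. norm (F x - F x0 - A *v (x - x0))"
  have "\<forall>\<^sub>F x in at x0 within \<Omega>. dist (?S x / norm (x - x0)) 0 < e"
    using assms(1) by (intro tendstoD \<open>e > 0\<close>) (simp add: semismooth_at_def)
  then obtain d2 where d2: "d2 > 0"
    "\<And>x. x \<in> \<Omega> \<Longrightarrow> x \<noteq> x0 \<Longrightarrow> dist x x0 < d2 \<Longrightarrow> \<bar>?S x / norm (x - x0)\<bar> < e"
    unfolding eventually_at by auto
  show thesis
  proof (rule that[of "min d1 d2"])
    fix x A assume x: "x \<in> \<Omega>" "dist x x0 < min d1 d2" and A: "A \<in> \<Psi> x"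
    show "norm (F x - F x0 - A *v (x - x0)) \<le> e * norm (x - x0)"
    proof (cases "x = x0")
      case False
      have "norm (F x - F x0 - B *v (x - x0)) \<le> norm (F x - F x0) + M * norm (x - x0)"
        if "B \<in> \<Psi> x" for B
      proof -
        have "norm B \<le> M"
          using U(3)[OF _ that] d1(2) x(2) by (auto simp: dist_commute)
        then have "norm (B *v (x - x0)) \<le> M * norm (x - x0)"
          using norm_matrix_vector_le[of B "x - x0"]
          by (meson mult_right_mono norm_ge_zero order_trans)
        then show ?thesis
          using norm_triangle_ineq4[of "F x - F x0" "B *v (x - x0)"] by linarith
      qed
      then have "bdd_above ((\<lambda>A. norm (F x - F x0 - A *v (x - x0))) ` \<Psi> x)"
        by (intro bdd_aboveI2) blast
      then have "norm (F x - F x0 - A *v (x - x0)) \<le> ?S x"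
        by (rule cSUP_upper[OF A])
      also have "\<dots> \<le> e * norm (x - x0)"
        using d2(2)[OF x(1) False] x(2) False by (simp add: field_simps abs_less_iff)
      finally show ?thesis .
    qed simp
  qed (use d1 d2 in auto)
qed

lemma semismooth_atI:
  assumes int: "x0 \<in> interior (mdom \<Psi>)" and "locally_bounded_at \<Psi> x0"
    and est: "\<And>e. e > 0 \<Longrightarrow> \<exists>d>0. \<forall>x\<in>\<Omega>. dist x x0 < d \<longrightarrow> (\<forall>A\<in>\<Psi> x.
      norm (F x - F x0 - A *v (x - x0)) \<le> e * norm (x - x0))"
  shows "semismooth_at \<Omega> F \<Psi> x0"
  unfolding semismooth_at_def
proof (intro conjI assms(1,2) tendstoI)
  fix e :: real assume "e > 0"
  let ?S = "\<lambda>x. SUP A\<in>\<Psi> x. norm (F x - F x0 - A *v (x - x0))"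
  \<comment> \<open>Halving leaves room for the strict inequality, as the supremum inherits only a
    weak one.\<close>
  obtain d where d: "d > 0" "\<And>x A. x \<in> \<Omega> \<Longrightarrow> dist x x0 < d \<Longrightarrow> A \<in> \<Psi> x \<Longrightarrow>
      norm (F x - F x0 - A *v (x - x0)) \<le> e / 2 * norm (x - x0)"
    using est[of "e/2"] \<open>e > 0\<close> by (meson half_gt_zero)
  obtain d' where d': "d' > 0" "ball x0 d' \<subseteq> mdom \<Psi>"
    using int mem_interior by blast
  have "dist (?S x / norm (x - x0)) 0 < e" if x: "x \<in> \<Omega>" "x \<noteq> x0" "dist x x0 < min d d'" for x
  proof -
    have ne: "\<Psi> x \<noteq> {}"
      using x d' by (auto simp: mdom_def dist_commute)
    have le: "?S x \<le> e / 2 * norm (x - x0)"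
      using d(2) x by (intro cSUP_least ne) auto
    obtain A where A: "A \<in> \<Psi> x" using ne by blast
    have "bdd_above ((\<lambda>A. norm (F x - F x0 - A *v (x - x0))) ` \<Psi> x)"
      using d(2) x by (intro bdd_aboveI2[of _ _ "e / 2 * norm (x - x0)"]) auto
    then have "0 \<le> ?S x"
      by (rule order_trans[OF norm_ge_zero cSUP_upper[OF A]])
    then show ?thesis
      using le x(2) \<open>e > 0\<close> by (simp add: field_simps) (smt (verit) mult_pos_pos zero_less_norm_iff eq_iff_diff_eq_0)
  qed
  then show "\<forall>\<^sub>F x in at x0 within \<Omega>. dist (?S x / norm (x - x0)) 0 < e"
    unfolding eventually_at using d(1) d'(1) by (intro exI[of _ "min d d'"]) auto
qed

lemma semismooth_on_nonempty:
  assumes "semismooth_on \<Omega> F \<Psi>" "x \<in> \<Omega>"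
  shows "\<Psi> x \<noteq> {}"
  using assms interior_subset unfolding semismooth_on_def semismooth_at_def mdom_def by blast

text \<open>The increment of \<open>F - A0\<close> from \<open>x\<close> to \<open>y\<close> is the
  semismoothness error at \<open>x\<close> plus the action of \<open>B - A0\<close>, with
  \<open>B\<close> in \<open>\<Psi> y\<close>. The point \<open>x0\<close> is excepted because the
  almost everywhere argument controls \<Psi> near \<open>x0\<close> but not at it.\<close>

lemma semismooth_lipschitz_on_ball:
  fixes A0 :: "real^'n^'m"
  assumes ss: "semismooth_on \<Omega> F \<Psi>" and sub: "ball x0 d \<subseteq> \<Omega>" and "K \<ge> 0" "e > 0"
    and K: "\<And>x B v. x \<in> ball x0 d \<Longrightarrow> x \<noteq> x0 \<Longrightarrow> B \<in> \<Psi> x \<Longrightarrow> norm ((B - A0) *v v) \<le> K * norm v"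
  shows "(K + e)-lipschitz_on (ball x0 d) (\<lambda>x. F x - A0 *v x)"
proof (rule lipschitz_on_convex_pointwise)
  fix x assume x: "x \<in> ball x0 d"
  then have "semismooth_at \<Omega> F \<Psi> x"
    using ss sub by (auto simp: semismooth_on_def)
  then obtain d1 where d1: "d1 > 0" "\<And>y B. y \<in> \<Omega> \<Longrightarrow> dist y x < d1 \<Longrightarrow> B \<in> \<Psi> y \<Longrightarrow>
      norm (F y - F x - B *v (y - x)) \<le> e * norm (y - x)"
    using semismooth_at_estimate[OF _ \<open>e > 0\<close>] by metis
  \<comment> \<open>For \<open>x \<noteq> x0\<close> the cap \<open>dist x x0\<close> keeps
    \<open>y\<close> off \<open>x0\<close>; for \<open>x = x0\<close> the choice
    \<open>y = x0\<close> is the trivial case \<open>y = x\<close>.\<close>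
  define d2 where "d2 = (if x = x0 then d1 else min d1 (dist x x0))"
  have "norm (F y - A0 *v y - (F x - A0 *v x)) \<le> (K + e) * norm (y - x)"
    if y: "y \<in> ball x0 d" "dist y x < d2" for y
  proof (cases "y = x")
    case False
    then have "y \<noteq> x0"
      using y(2) by (auto simp: d2_def dist_commute split: if_splits)
    have "y \<in> \<Omega>" using y(1) sub by blast
    then obtain B where B: "B \<in> \<Psi> y"
      using semismooth_on_nonempty[OF ss] by blast
    have "dist y x < d1"
      using y(2) by (auto simp: d2_def split: if_splits)
    have "F y - A0 *v y - (F x - A0 *v x) = (F y - F x - B *v (y - x)) + (B - A0) *v (y - x)"
      by (simp add: algebra_simps)
    then have "norm (F y - A0 *v y - (F x - A0 *v x)) \<le> e * norm (y - x) + K * norm (y - x)"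
      using norm_triangle_mono[OF d1(2)[OF \<open>y \<in> \<Omega>\<close> \<open>dist y x < d1\<close> B]
          K[OF y(1) \<open>y \<noteq> x0\<close> B, of "y - x"]]
      by (simp only:)
    then show ?thesis by (simp add: algebra_simps)
  qed simp
  moreover have "d2 > 0" using d1 by (simp add: d2_def)
  ultimately show "\<exists>d'>0. \<forall>y\<in>ball x0 d. dist y x < d' \<longrightarrow>
      norm (F y - A0 *v y - (F x - A0 *v x)) \<le> (K + e) * norm (y - x)"
    by blast
qed (use assms in auto)

lemma semismooth_imp_locally_lipschitz:
  assumes "open \<Omega>" "semismooth_on \<Omega> F \<Psi>"
  shows "locally_lipschitz_on \<Omega> F"
  unfolding locally_lipschitz_on_def
proof
  fix x0 assume x0: "x0 \<in> \<Omega>"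
  then have "locally_bounded_at \<Psi> x0"
    using assms(2) by (simp add: semismooth_on_def semismooth_at_def)
  then obtain U M where U: "open U" "x0 \<in> U" "M \<ge> 0" "\<And>x A. x \<in> U \<Longrightarrow> A \<in> \<Psi> x \<Longrightarrow> norm A \<le> M"
    unfolding locally_bounded_at_def by blast
  obtain d where d: "d > 0" "ball x0 d \<subseteq> U \<inter> \<Omega>"
    using openE[of "U \<inter> \<Omega>" x0] assms(1) U x0 by auto
  \<comment> \<open>With \<open>A0 = 0\<close>, the local bound \<open>M\<close> on \<Psi> serves as
    \<open>K\<close>, and the slack is 1.\<close>
  have "(M + 1)-lipschitz_on (ball x0 d) (\<lambda>x. F x - 0 *v x)"
  proof (rule semismooth_lipschitz_on_ball[OF assms(2)])
    fix x B v assume "x \<in> ball x0 d" "B \<in> \<Psi> x"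
    then have "norm B \<le> M" using U d by auto
    then show "norm ((B - 0) *v v) \<le> M * norm v"
      using norm_matrix_vector_le[of B v] by (simp, meson mult_right_mono norm_ge_zero order_trans)
  qed (use U d in auto)
  then show "lipschitz_near \<Omega> F x0"
    unfolding lipschitz_near_def using d by (intro exI[of _ "ball x0 d"] exI[of _ "M + 1"]) auto
qed

subsection \<open>Strict differentiability almost everywhere\<close>

text \<open>Points \<open>z'\<close>, \<open>z\<close> of \<open>T\<close> close to \<open>x\<close> and to \<open>x - r v / |v|\<close> (\<open>r = |x - x0|\<close>) turn the estimates
  along \<open>z' - z\<close> into a bound for \<open>(B - Q) v\<close>, up to half of the operator norm of \<open>B - Q\<close>.\<close>

lemma semismooth_value_close:
  fixes \<Psi> :: "real^'n \<Rightarrow> (real^'n^'m) set"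
  assumes np: "\<And>r y. 0 < r \<Longrightarrow> r < \<rho> \<Longrightarrow> dist x0 y \<le> 2 * r \<Longrightarrow> T \<inter> ball y (r/4) \<noteq> {}"
    and est: "\<And>z x B. z \<in> T \<Longrightarrow> x \<in> \<Omega> \<Longrightarrow> dist x z < 3 * \<rho> \<Longrightarrow> B \<in> \<Psi> x \<Longrightarrow>
      norm (F x - F z - B *v (x - z)) \<le> e * norm (x - z)"
    and sel: "\<And>z. z \<in> T \<Longrightarrow> A z \<in> \<Psi> z" and Q: "\<And>z. z \<in> T \<Longrightarrow> norm (A z - Q) \<le> e"
    and T: "T \<subseteq> \<Omega>" "x0 \<in> T"
    and x: "x \<in> \<Omega>" "x \<noteq> x0" "dist x x0 < \<rho>" and B: "B \<in> \<Psi> x"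
  shows "norm ((B - A x0) *v v) \<le> 18 * e * norm v"
proof -
  have "e \<ge> 0" using Q[OF T(2)] norm_ge_zero order_trans by blast
  define r where "r = dist x x0"
  have r: "0 < r" "r < \<rho>" using x by (auto simp: r_def)
  define N where "N = onorm ((*v) (B - Q))"
  have bl: "bounded_linear ((*v) (B - Q))"
    by (rule matrix_vector_mul_bounded_linear)
  have N: "norm ((B - Q) *v w) \<le> N * norm w" for w
    using onorm[OF bl] by (simp add: N_def)
  have AQ: "norm ((A z - Q) *v w) \<le> e * norm w" if "z \<in> T" for z w
    using norm_matrix_vector_le[of "A z - Q" w] mult_right_mono[OF Q[OF that] norm_ge_zero[of w]] by linarith
  \<comment> \<open>The estimate based at \<open>x0\<close> holds with \<open>A z\<close>;
    exchanging it for the common matrix \<open>Q\<close> costs a second \<open>e\<close>.\<close>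
  have ex: "norm (F z - F x0 - Q *v (z - x0)) \<le> 2 * e * norm (z - x0)" if z: "z \<in> T" "norm (z - x0) < 3 * \<rho>" for z
  proof -
    have 1: "norm (F z - F x0 - A z *v (z - x0)) \<le> e * norm (z - x0)"
      using est[OF T(2) _ _ sel[OF z(1)]] z T(1) by (auto simp: dist_norm)
    have 2: "F z - F x0 - Q *v (z - x0) = (F z - F x0 - A z *v (z - x0)) + (A z - Q) *v (z - x0)"
      by (simp add: algebra_simps)
    show ?thesis
      using norm_triangle_mono[OF 1 AQ[OF z(1), of "z - x0"]] unfolding 2 by linarith
  qed
  \<comment> \<open>A self-improving bound: absorbing the half of \<open>N\<close> on the left gives
    \<open>N \<le> 17 * e\<close>.\<close>
  have "N \<le> 17/2 * e + N / 2"
    unfolding N_def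
  proof (rule onorm_bound)
    fix v :: "real^'n"
    show "norm ((B - Q) *v v) \<le> (17/2 * e + onorm ((*v) (B - Q)) / 2) * norm v"
    proof (cases "v = 0")
      case False
      \<comment> \<open>The segment from \<open>y\<close> to \<open>x\<close> has direction
        \<open>v\<close> and length \<open>r\<close>, and both ends are within \<open>2 * r\<close>
        of \<open>x0\<close>, where no ball of radius \<open>r/4\<close> misses
        \<open>T\<close>.\<close>
      define y where "y = x - (r / norm v) *\<^sub>R v"
      have xy: "norm (x - y) = r" using False r by (simp add: y_def)
      have "dist x0 y \<le> 2 * r"
        using dist_triangle[of x0 y x] xy by (simp add: r_def dist_norm norm_minus_commute)
      then obtain z where z: "z \<in> T" "norm (z - y) < r / 4"
        using np[OF r, of y] by (auto simp: dist_norm norm_minus_commute)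
      obtain z' where z': "z' \<in> T" "norm (z' - x) < r / 4"
        using np[OF r, of x] r by (auto simp: dist_norm norm_minus_commute r_def)
      have xx0: "norm (x - x0) = r" by (simp add: r_def dist_norm)
      have d1: "norm (x - z') \<le> r / 4" using z' by (simp add: norm_minus_commute)
      have d2: "norm (x - z) \<le> 5/4 * r"
        using norm_triangle_ineq[of "x - y" "y - z"] xy z by (simp add: norm_minus_commute)
      have d3: "norm (z' - x0) \<le> 5/4 * r"
        using norm_triangle_ineq[of "z' - x" "x - x0"] xx0 z' by simp
      have d4: "norm (z - x0) \<le> 9/4 * r"
        using norm_triangle_ineq[of "z - x" "x - x0"] xx0 d2 by (simp add: norm_minus_commute)
      have e1: "norm (F x - F z' - B *v (x - z')) \<le> e * (r / 4)"
        using est[OF z'(1) x(1) _ B] d1 r mult_left_mono[OF d1 \<open>e \<ge> 0\<close>] by (simp add: dist_norm)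
      have e2: "norm (F x - F z - B *v (x - z)) \<le> e * (5/4 * r)"
        using est[OF z(1) x(1) _ B] d2 r mult_left_mono[OF d2 \<open>e \<ge> 0\<close>] by (simp add: dist_norm)
      have e3: "norm (F z' - F x0 - Q *v (z' - x0)) \<le> 2 * e * (5/4 * r)"
        using ex[OF z'(1)] d3 r mult_left_mono[OF d3, of "2 * e"] \<open>e \<ge> 0\<close> by simp
      have e4: "norm (F z - F x0 - Q *v (z - x0)) \<le> 2 * e * (9/4 * r)"
        using ex[OF z(1)] d4 r mult_left_mono[OF d4, of "2 * e"] \<open>e \<ge> 0\<close> by simp
      \<comment> \<open>All values of \<open>F\<close> cancel: \<open>B\<close> is tested from
        \<open>x\<close>, and \<open>Q\<close> from \<open>x0\<close>. The constant is 1/4 + 5/4 +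
        5/2 + 9/2 = 17/2.\<close>
      have "(B - Q) *v (z' - z) = ((F x - F z' - B *v (x - z')) - (F x - F z - B *v (x - z)))
          + ((F z' - F x0 - Q *v (z' - x0)) - (F z - F x0 - Q *v (z - x0)))"
        by (simp add: algebra_simps)
      also have "norm \<dots> \<le> (e * (r / 4) + e * (5/4 * r)) + (2 * e * (5/4 * r) + 2 * e * (9/4 * r))"
        by (intro norm_triangle_mono norm_triangle_le_diff add_mono e1 e2 e3 e4)
      also have "\<dots> = 17/2 * e * r" by (simp add: algebra_simps)
      finally have main: "norm ((B - Q) *v (z' - z)) \<le> 17/2 * e * r" .
      \<comment> \<open>The error of replacing \<open>x - y\<close> by \<open>z' - z\<close>; its
        length of at most \<open>r/2\<close> produces the term \<open>N/2\<close>.\<close>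
      define w where "w = (z' - x) - (z - y)"
      have "norm w \<le> r / 2"
        using norm_triangle_ineq4[of "z' - x" "z - y"] z z' by (simp add: w_def)
      then have "norm ((B - Q) *v w) \<le> N * (r / 2)"
        using N[of w] onorm_pos_le[OF bl] mult_left_mono[of "norm w" "r/2" N] by (simp add: N_def)
      moreover have "(B - Q) *v ((r / norm v) *\<^sub>R v) = (B - Q) *v (z' - z) - (B - Q) *v w"
        by (simp add: w_def y_def flip: matrix_vector_mult_diff_distrib)
      ultimately have "norm ((B - Q) *v ((r / norm v) *\<^sub>R v)) \<le> 17/2 * e * r + N * (r / 2)"
        using norm_triangle_ineq4[of "(B - Q) *v (z' - z)" "(B - Q) *v w"] main by (simp only:)
      moreover have "norm ((B - Q) *v ((r / norm v) *\<^sub>R v)) = r * (norm ((B - Q) *v v) / norm v)"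
        using r by (simp add: matrix_vector_mult_scaleR)
      ultimately have "r * (norm ((B - Q) *v v) / norm v) \<le> r * (17/2 * e + N / 2)"
        by (simp add: distrib_left mult.commute)
      then have "norm ((B - Q) *v v) / norm v \<le> 17/2 * e + N / 2"
        by (rule mult_left_le_imp_le[OF _ r(1)])
      then show ?thesis
        using False by (simp add: field_simps N_def)
    qed simp
  qed (use \<open>e \<ge> 0\<close> onorm_pos_le[OF bl] in auto)
  then have "N \<le> 17 * e" by simp
  then have "norm ((B - Q) *v v) \<le> 17 * e * norm v"
    using N[of v] by (meson mult_right_mono norm_ge_zero order_trans)
  moreover have "(B - A x0) *v v = (B - Q) *v v - (A x0 - Q) *v v"
    by (simp add: algebra_simps)
  ultimately show ?thesis
    using AQ[OF T(2), of v] norm_triangle_ineq4[of "(B - Q) *v v" "(A x0 - Q) *v v"]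
    by (simp add: algebra_simps)
qed

text \<open>For each \<open>j\<close>, every point of \<Omega> lies in some
  \<open>T (j, k, Q)\<close>. Discarding the porosity points of these countably many sets leaves
  points where \<open>semismooth_value_close\<close> applies at every accuracy. The limit is the
  selected value \<open>A x0\<close>, the same for all \<open>e\<close>.\<close>

lemma semismooth_values_converge_ae:
  fixes F :: "real^'n \<Rightarrow> real^'m"
  assumes "open \<Omega>" and ss: "semismooth_on \<Omega> F \<Psi>"
  obtains N where "negligible N"
    "\<And>x0. x0 \<in> \<Omega> - N \<Longrightarrow> \<exists>A0. \<forall>e>0. \<exists>d>0. \<forall>x\<in>\<Omega>. x \<noteq> x0 \<longrightarrow> dist x x0 < d \<longrightarrow>
       (\<forall>B\<in>\<Psi> x. \<forall>v. norm ((B - A0) *v v) \<le> e * norm v)"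
proof -
  define A where "A x = (SOME B. B \<in> \<Psi> x)" for x
  have A: "A x \<in> \<Psi> x" if "x \<in> \<Omega>" for x
    using semismooth_on_nonempty[OF ss that] by (auto simp: A_def some_in_eq)
  obtain D :: "(real^'n^'m) set" where D: "countable D" "\<And>X. open X \<Longrightarrow> X \<noteq> {} \<Longrightarrow> \<exists>Q\<in>D. Q \<in> X"
    by (rule countable_dense_setE) blast
  \<comment> \<open>Here \<open>j\<close> is the accuracy, \<open>k\<close> the scale on which the
    estimate based at \<open>z\<close> holds, and \<open>Q\<close> the approximate value of the
    selection.\<close>
  define T where "T = (\<lambda>(j, k, Q). {z \<in> \<Omega>. norm (A z - Q) \<le> inverse (real (Suc j)) \<and>
    (\<forall>x\<in>\<Omega>. dist x z < inverse (real (Suc k)) \<longrightarrow> (\<forall>B\<in>\<Psi> x.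
      norm (F x - F z - B *v (x - z)) \<le> inverse (real (Suc j)) * norm (x - z)))})"
  define P where "P S = {x \<in> S. \<forall>d>0. \<exists>r y. 0 < r \<and> r < d \<and> dist x y \<le> 2 * r \<and> S \<inter> ball y (r/4) = {}}"
    for S :: "(real^'n) set"
  let ?N = "\<Union>p\<in>UNIV \<times> UNIV \<times> D. P (T p)"
  show thesis
  proof (rule that[of ?N])
    show "negligible ?N"
    proof (rule negligible_countable_Union)
      show "countable ((\<lambda>p. P (T p)) ` (UNIV \<times> UNIV \<times> D))"
        using D(1) by (intro countable_image countable_SIGMA) auto
      show "negligible S" if "S \<in> (\<lambda>p. P (T p)) ` (UNIV \<times> UNIV \<times> D)" for S
        using that negligible_porosity_points by (auto simp: P_def)
    qed
    fix x0 assume x0: "x0 \<in> \<Omega> - ?N"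
    have "\<exists>d>0. \<forall>x\<in>\<Omega>. x \<noteq> x0 \<longrightarrow> dist x x0 < d \<longrightarrow>
       (\<forall>B\<in>\<Psi> x. \<forall>v. norm ((B - A x0) *v v) \<le> e * norm v)" if "e > 0" for e
    proof -
      obtain j where j: "inverse (real (Suc j)) < e / 18"
        using reals_Archimedean[of "e / 18"] \<open>e > 0\<close> by auto
      define q where "q = inverse (real (Suc j))"
      have "q > 0" by (simp add: q_def)
      have "semismooth_at \<Omega> F \<Psi> x0"
        using ss x0 by (auto simp: semismooth_on_def)
      then obtain d where d: "d > 0" "\<And>x B. x \<in> \<Omega> \<Longrightarrow> dist x x0 < d \<Longrightarrow> B \<in> \<Psi> x \<Longrightarrow>
          norm (F x - F x0 - B *v (x - x0)) \<le> q * norm (x - x0)"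
        using semismooth_at_estimate[OF _ \<open>q > 0\<close>] by metis
      obtain k where k: "inverse (real (Suc k)) < d"
        using reals_Archimedean d(1) by blast
      obtain Q where Q: "Q \<in> D" "Q \<in> ball (A x0) q"
        using D(2)[of "ball (A x0) q"] \<open>q > 0\<close> by auto
      let ?T = "T (j, k, Q)"
      have "x0 \<in> ?T"
        using x0 Q(2) d(2)[OF _ less_trans[OF _ k]]
        by (auto simp: T_def dist_norm q_def simp del: of_nat_Suc)
      moreover have "x0 \<notin> P ?T"
        using x0 Q(1) by auto
      ultimately obtain \<delta> where \<delta>: "\<delta> > 0"
        "\<And>r y. 0 < r \<Longrightarrow> r < \<delta> \<Longrightarrow> dist x0 y \<le> 2 * r \<Longrightarrow> ?T \<inter> ball y (r/4) \<noteq> {}"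
        unfolding P_def by blast
      \<comment> \<open>The division by 3 allows estimates up to distance
        \<open>3 * \<rho>\<close>.\<close>
      define \<rho> where "\<rho> = min \<delta> (inverse (real (Suc k)) / 3)"
      have "\<rho> > 0" using \<delta>(1) by (simp add: \<rho>_def)
      have "norm ((B - A x0) *v v) \<le> e * norm v"
        if x: "x \<in> \<Omega>" "x \<noteq> x0" "dist x x0 < \<rho>" and B: "B \<in> \<Psi> x" for x B v
      proof -
        have "norm ((B - A x0) *v v) \<le> 18 * q * norm v"
        proof (rule semismooth_value_close[where \<rho> = \<rho> and T = ?T and A = A and Q = Q and \<Psi> = \<Psi> and F = F])
          show "?T \<inter> ball y (r/4) \<noteq> {}" if "0 < r" "r < \<rho>" "dist x0 y \<le> 2 * r" for r y
            using \<delta>(2)[OF that(1) _ that(3)] that(2) by (simp add: \<rho>_def)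
          show "norm (F x - F z - B *v (x - z)) \<le> q * norm (x - z)"
            if "z \<in> ?T" "x \<in> \<Omega>" "dist x z < 3 * \<rho>" "B \<in> \<Psi> x" for z x B
            using that by (simp add: T_def \<rho>_def q_def)
        qed (use A x B \<open>x0 \<in> ?T\<close> in \<open>auto simp: T_def q_def\<close>)
        also have "\<dots> \<le> e * norm v"
          using j by (intro mult_right_mono) (auto simp: q_def)
        finally show ?thesis .
      qed
      then show ?thesis using \<open>\<rho> > 0\<close> by blast
    qed
    then show "\<exists>A0. \<forall>e>0. \<exists>d>0. \<forall>x\<in>\<Omega>. x \<noteq> x0 \<longrightarrow> dist x x0 < d \<longrightarrow>
       (\<forall>B\<in>\<Psi> x. \<forall>v. norm ((B - A0) *v v) \<le> e * norm v)"
      by blast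
  qed
qed

text \<open>Small Lipschitz constants of the remainder \<open>F - A\<close> control its difference
  quotients uniformly in base point and step, as the joint limit demands.\<close>

lemma strictly_differentiable_atI:
  fixes A :: "real^'n^'m"
  assumes est: "\<And>e. e > 0 \<Longrightarrow> \<exists>d>0. ball x0 d \<subseteq> \<Omega> \<and> e-lipschitz_on (ball x0 d) (\<lambda>x. F x - A *v x)"
  shows "strictly_differentiable_at \<Omega> F x0"
  unfolding strictly_differentiable_at_def
proof (intro conjI exI[of _ A] allI tendstoI)
  obtain d where d: "d > 0" "ball x0 d \<subseteq> \<Omega>" "1-lipschitz_on (ball x0 d) (\<lambda>x. F x - A *v x)"
    using est[of 1] by auto
  have "(norm A)-lipschitz_on (ball x0 d) (\<lambda>x. A *v x)"
    by (rule lipschitz_onI)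
      (simp_all add: dist_norm norm_matrix_vector_le flip: matrix_vector_mult_diff_distrib)
  from lipschitz_on_add[OF d(3) this] show "lipschitz_near \<Omega> F x0"
    unfolding lipschitz_near_def using d by (intro exI[of _ "ball x0 d"] exI[of _ "1 + norm A"]) simp
next
  fix u :: "real^'n" and e :: real assume "e > 0"
  have pos: "norm u + 1 > 0" by (simp add: add_nonneg_pos)
  define q where "q = e / (norm u + 1)"
  have "q > 0" using \<open>e > 0\<close> pos by (simp add: q_def)
  have q: "q * norm u < e"
    unfolding q_def times_divide_eq_left pos_divide_less_eq[OF pos]
    using \<open>e > 0\<close> by (simp add: algebra_simps)
  obtain d where d: "d > 0" "q-lipschitz_on (ball x0 d) (\<lambda>x. F x - A *v x)"
    using est[OF \<open>q > 0\<close>] by blast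
  \<comment> \<open>For base points within \<open>d/2\<close> of \<open>x0\<close> and steps below
    \<open>s\<close>, both \<open>x\<close> and \<open>x + t *\<^sub>R u\<close> stay in
    \<open>ball x0 d\<close>.\<close>
  define s where "s = d / 2 / (norm u + 1)"
  have "s > 0" using d pos by (simp add: s_def)
  have s: "s * norm u < d / 2"
    unfolding s_def times_divide_eq_left[of "d / 2"] pos_divide_less_eq[OF pos]
    using d by (simp add: algebra_simps)
  have "\<forall>\<^sub>F p in nhds x0 \<times>\<^sub>F at_right (0::real). fst p \<in> ball x0 (d/2) \<and> snd p \<in> {0<..<s}"
  proof (rule eventually_prodI)
    show "\<forall>\<^sub>F x in nhds x0. x \<in> ball x0 (d/2)"
      using d by (intro eventually_nhds_in_open) auto
    show "\<forall>\<^sub>F t in at_right 0. t \<in> {0<..<s}"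
      using \<open>s > 0\<close> eventually_at_right_real by blast
  qed
  then show "\<forall>\<^sub>F p in nhds x0 \<times>\<^sub>F at_right 0.
      dist (case p of (x, t) \<Rightarrow> (F (x + t *\<^sub>R u) - F x) /\<^sub>R t) (A *v u) < e"
  proof (rule eventually_mono, clarify)
    fix x and t :: real assume "fst (x, t) \<in> ball x0 (d/2)" "snd (x, t) \<in> {0<..<s}"
    then have xt: "dist x0 x < d / 2" "0 < t" "t < s" by auto
    have "t * norm u < d / 2"
      using s mult_right_mono[of t s "norm u"] xt(3) by simp
    then have "x + t *\<^sub>R u \<in> ball x0 d" "x \<in> ball x0 d"
      using xt dist_triangle[of x0 "x + t *\<^sub>R u" x] d(1) by (auto simp: dist_norm)
    from lipschitz_onD[OF d(2) this]
    have le: "norm (F (x + t *\<^sub>R u) - F x - t *\<^sub>R (A *v u)) \<le> q * (t * norm u)"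
      using xt(2) by (simp add: dist_norm matrix_vector_right_distrib matrix_vector_mult_scaleR algebra_simps)
    have "(F (x + t *\<^sub>R u) - F x) /\<^sub>R t - A *v u = (F (x + t *\<^sub>R u) - F x - t *\<^sub>R (A *v u)) /\<^sub>R t"
      using xt(2) by (simp add: scaleR_diff_right)
    then have "dist ((F (x + t *\<^sub>R u) - F x) /\<^sub>R t) (A *v u)
        = norm (F (x + t *\<^sub>R u) - F x - t *\<^sub>R (A *v u)) / t"
      using xt(2) by (simp add: dist_norm divide_inverse mult.commute)
    also have "\<dots> \<le> q * norm u"
      using le xt(2) by (simp add: divide_le_eq algebra_simps)
    finally show "dist ((F (x + t *\<^sub>R u) - F x) /\<^sub>R t) (A *v u) < e"
      using q by simp
  qed
qed

text \<open>Convergence of \<Psi> to \<open>A0\<close> makes the Lipschitz constant of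
  \<open>F - A0\<close> arbitrarily small near \<open>x0\<close>. Frechet differentiability is
  recorded as well, because the density of \<open>diff_points\<close> rests on it.\<close>

lemma semismooth_strictly_differentiable_ae:
  fixes F :: "real^'n \<Rightarrow> real^'m"
  assumes "open \<Omega>" and ss: "semismooth_on \<Omega> F \<Psi>"
  shows "negligible {x \<in> \<Omega>. \<not> (strictly_differentiable_at \<Omega> F x \<and> F differentiable (at x))}"
proof -
  obtain N where N: "negligible N"
    "\<And>x0. x0 \<in> \<Omega> - N \<Longrightarrow> \<exists>A0. \<forall>e>0. \<exists>d>0. \<forall>x\<in>\<Omega>. x \<noteq> x0 \<longrightarrow> dist x x0 < d \<longrightarrow>
       (\<forall>B\<in>\<Psi> x. \<forall>v. norm ((B - A0) *v v) \<le> e * norm v)"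
    using semismooth_values_converge_ae[OF assms] by metis
  have good: "strictly_differentiable_at \<Omega> F x0 \<and> F differentiable (at x0)" if x0: "x0 \<in> \<Omega> - N" for x0
  proof -
    obtain A0 where A0: "\<And>e. e > 0 \<Longrightarrow> \<exists>d>0. \<forall>x\<in>\<Omega>. x \<noteq> x0 \<longrightarrow> dist x x0 < d \<longrightarrow>
       (\<forall>B\<in>\<Psi> x. \<forall>v. norm ((B - A0) *v v) \<le> e * norm v)"
      using N(2)[OF x0] by blast
    obtain d0 where d0: "d0 > 0" "ball x0 d0 \<subseteq> \<Omega>"
      using openE[OF assms(1)] x0 by blast
    have est: "\<exists>d>0. ball x0 d \<subseteq> \<Omega> \<and> e-lipschitz_on (ball x0 d) (\<lambda>x. F x - A0 *v x)" if "e > 0" for e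
    proof -
      obtain d1 where d1: "d1 > 0" "\<And>x B v. x \<in> \<Omega> \<Longrightarrow> x \<noteq> x0 \<Longrightarrow> dist x x0 < d1 \<Longrightarrow> B \<in> \<Psi> x \<Longrightarrow>
          norm ((B - A0) *v v) \<le> e / 2 * norm v"
        using A0[of "e/2"] \<open>e > 0\<close> by (meson half_gt_zero)
      let ?d = "min d0 d1"
      have sub: "ball x0 ?d \<subseteq> \<Omega>" using d0(2) by auto
      have "(e/2 + e/2)-lipschitz_on (ball x0 ?d) (\<lambda>x. F x - A0 *v x)"
      proof (rule semismooth_lipschitz_on_ball[OF ss sub])
        fix x B v assume "x \<in> ball x0 ?d" "x \<noteq> x0" "B \<in> \<Psi> x"
        then show "norm ((B - A0) *v v) \<le> e / 2 * norm v"
          using d1(2) sub by (auto simp: dist_commute)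
      qed (use \<open>e > 0\<close> in auto)
      then show ?thesis
        using sub d0(1) d1(1) by (intro exI[of _ ?d]) simp
    qed
    have "(F has_derivative (\<lambda>v. A0 *v v)) (at x0)"
      unfolding has_derivative_at_alt
    proof (intro conjI allI impI matrix_vector_mul_bounded_linear)
      fix e :: real assume "e > 0"
      then obtain d where d: "d > 0" "e-lipschitz_on (ball x0 d) (\<lambda>x. F x - A0 *v x)"
        using est by blast
      have "norm (F y - F x0 - A0 *v (y - x0)) \<le> e * norm (y - x0)" if "norm (y - x0) < d" for y
        using lipschitz_onD[OF d(2), of y x0] that d(1)
        by (simp add: dist_norm norm_minus_commute algebra_simps)
      then show "\<exists>d>0. \<forall>y. norm (y - x0) < d \<longrightarrow> norm (F y - F x0 - A0 *v (y - x0)) \<le> e * norm (y - x0)"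
        using d(1) by blast
    qed
    then show ?thesis
      using strictly_differentiable_atI[OF est] differentiableI by blast
  qed
  show ?thesis
    by (rule negligible_subset[OF N(1)]) (use good in auto)
qed

section \<open>Jacobians compared with nearby values of the multifunction\<close>

text \<open>The same value of \<open>F\<close> is expanded at \<open>x\<close> once by the
  derivative and once by semismoothness. The comparison shows closeness only in the direction
  \<open>v\<close>, and \<open>B\<close> depends on \<open>v\<close>.\<close>

lemma jacobian_approx:
  fixes F :: "real^'n \<Rightarrow> real^'m"
  assumes "open \<Omega>" and ss: "semismooth_on \<Omega> F \<Psi>" and x: "x \<in> diff_points \<Omega> F"
    and "\<eta> > 0" "\<delta> > 0"
  obtains t B where "0 < t" "t < \<delta>" "x + t *\<^sub>R v \<in> \<Omega>" "B \<in> \<Psi> (x + t *\<^sub>R v)"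
    "norm (F (x + t *\<^sub>R v) - F x - t *\<^sub>R (B *v v)) \<le> \<eta> * t * norm v"
    "norm ((B - jacobian F (at x)) *v v) \<le> 2 * \<eta> * norm v"
proof -
  let ?J = "jacobian F (at x)"
  have xO: "x \<in> \<Omega>" and "F differentiable (at x)"
    using x by (auto simp: diff_points_def)
  then have "(F has_derivative (\<lambda>h. ?J *v h)) (at x)"
    by (simp add: jacobian_works)
  then obtain d1 where d1: "d1 > 0" "\<And>y. norm (y - x) < d1 \<Longrightarrow>
      norm (F y - F x - ?J *v (y - x)) \<le> \<eta> * norm (y - x)"
    using \<open>\<eta> > 0\<close> unfolding has_derivative_at_alt by blast
  have "semismooth_at \<Omega> F \<Psi> x"
    using ss xO by (auto simp: semismooth_on_def)
  then obtain d2 where d2: "d2 > 0" "\<And>y B. y \<in> \<Omega> \<Longrightarrow> dist y x < d2 \<Longrightarrow> B \<in> \<Psi> y \<Longrightarrow>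
      norm (F y - F x - B *v (y - x)) \<le> \<eta> * norm (y - x)"
    using semismooth_at_estimate[OF _ \<open>\<eta> > 0\<close>] by metis
  obtain d3 where d3: "d3 > 0" "ball x d3 \<subseteq> \<Omega>"
    using openE[OF assms(1) xO] by blast
  define s where "s = min d1 (min d2 d3)"
  have "s > 0" using d1 d2 d3 by (simp add: s_def)
  have pos: "norm v + 1 > 0" by (simp add: add_nonneg_pos)
  define t where "t = min (\<delta> / 2) (s / (norm v + 1))"
  have t: "0 < t" "t < \<delta>"
    using \<open>\<delta> > 0\<close> \<open>s > 0\<close> pos by (auto simp: t_def min_less_iff_disj)
  have "t * norm v \<le> s / (norm v + 1) * norm v"
    by (intro mult_right_mono) (auto simp: t_def)
  also have "\<dots> < s"
    unfolding times_divide_eq_left pos_divide_less_eq[OF pos]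
    using \<open>s > 0\<close> by (simp add: algebra_simps)
  finally have ts: "t * norm v < s" .
  let ?y = "x + t *\<^sub>R v"
  have y: "?y \<in> \<Omega>"
    using ts t d3(2) by (auto simp: dist_norm s_def)
  then obtain B where B: "B \<in> \<Psi> ?y"
    using semismooth_on_nonempty[OF ss] by blast
  have 1: "norm (F ?y - F x - t *\<^sub>R (?J *v v)) \<le> \<eta> * t * norm v"
    using d1(2)[of ?y] ts t by (simp add: s_def matrix_vector_mult_scaleR)
  have 2: "norm (F ?y - F x - t *\<^sub>R (B *v v)) \<le> \<eta> * t * norm v"
    using d2(2)[OF y _ B] ts t by (simp add: s_def matrix_vector_mult_scaleR dist_norm)
  have "t *\<^sub>R ((B - ?J) *v v) = (F ?y - F x - t *\<^sub>R (?J *v v)) - (F ?y - F x - t *\<^sub>R (B *v v))"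
    by (simp add: algebra_simps)
  then have "norm (t *\<^sub>R ((B - ?J) *v v)) \<le> \<eta> * t * norm v + \<eta> * t * norm v"
    using norm_triangle_le_diff[OF add_mono[OF 1 2]] by simp
  then have "t * norm ((B - ?J) *v v) \<le> t * (2 * \<eta> * norm v)"
    using t by (simp only: norm_scaleR abs_of_pos) (simp add: algebra_simps)
  then have "norm ((B - ?J) *v v) \<le> 2 * \<eta> * norm v"
    using t(1) by (rule mult_left_le_imp_le)
  then show thesis
    using that[OF t y B 2] by blast
qed

subsection \<open>Semismoothness with respect to the B-Jacobian\<close>

text \<open>In each direction \<open>v\<close>, the Jacobian differs by at most
  \<open>norm v\<close> from some matrix in \<Psi>, which raises the bound \<open>M\<close> to
  \<open>M + 1\<close>.\<close>

lemma jacobian_locally_bounded: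
  fixes F :: "real^'n \<Rightarrow> real^'m"
  assumes "open \<Omega>" and ss: "semismooth_on \<Omega> F \<Psi>" and "x0 \<in> \<Omega>"
  obtains d C where "d > 0" "C \<ge> 0"
    "\<And>x. x \<in> diff_points \<Omega> F \<Longrightarrow> dist x0 x < d \<Longrightarrow> norm (jacobian F (at x)) \<le> C"
proof -
  have "locally_bounded_at \<Psi> x0"
    using ss \<open>x0 \<in> \<Omega>\<close> by (simp add: semismooth_on_def semismooth_at_def)
  then obtain U M where U: "open U" "x0 \<in> U" "M \<ge> 0" "\<And>x A. x \<in> U \<Longrightarrow> A \<in> \<Psi> x \<Longrightarrow> norm A \<le> M"
    unfolding locally_bounded_at_def by blast
  obtain d where d: "d > 0" "ball x0 d \<subseteq> U"
    using openE[OF U(1,2)] by blast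
  have J: "norm (jacobian F (at x) *v v) \<le> (M + 1) * norm v"
    if x: "x \<in> diff_points \<Omega> F" "dist x0 x < d" for x v
  proof -
    \<comment> \<open>Keeps \<open>x + t *\<^sub>R v\<close> in the ball on which \<Psi> is
      bounded.\<close>
    define \<delta> where "\<delta> = (d - dist x0 x) / (norm v + 1)"
    have pos: "norm v + 1 > 0" by (simp add: add_nonneg_pos)
    have "\<delta> > 0" using x(2) pos by (simp add: \<delta>_def)
    obtain t B where tB: "0 < t" "t < \<delta>" "B \<in> \<Psi> (x + t *\<^sub>R v)"
      "norm ((B - jacobian F (at x)) *v v) \<le> 2 * (1/2) * norm v"
      by (rule jacobian_approx[OF assms(1) ss x(1) _ \<open>\<delta> > 0\<close>, of "1/2" v]) auto
    have "t * norm v \<le> \<delta> * norm v"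
      using tB(2) by (intro mult_right_mono) auto
    also have "\<dots> < d - dist x0 x"
      unfolding \<delta>_def times_divide_eq_left pos_divide_less_eq[OF pos]
      using x(2) by (simp add: algebra_simps)
    finally have "x + t *\<^sub>R v \<in> ball x0 d"
      using dist_triangle[of x0 "x + t *\<^sub>R v" x] tB(1) by (simp add: dist_norm)
    then have "norm B \<le> M"
      using U(4)[OF _ tB(3)] d(2) by auto
    then have "norm (B *v v) \<le> M * norm v"
      using norm_matrix_vector_le[of B v] by (meson mult_right_mono norm_ge_zero order_trans)
    moreover have "jacobian F (at x) *v v = B *v v - (B - jacobian F (at x)) *v v"
      by (simp add: algebra_simps)
    ultimately show ?thesis
      using norm_triangle_ineq4[of "B *v v" "(B - jacobian F (at x)) *v v"] tB(4)
      by (simp add: distrib_right)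
  qed
  show thesis
    by (rule that[OF d(1) _ norm_matrix_le_of_apply[OF J]]) (use U(3) in auto)
qed

text \<open>A nonempty open set cannot lie in the null set of exceptional points.\<close>

lemma diff_points_dense:
  assumes "open \<Omega>" "semismooth_on \<Omega> F \<Psi>" "x0 \<in> \<Omega>" "d > 0"
  obtains x where "x \<in> diff_points \<Omega> F" "dist x0 x < d"
proof (rule ccontr)
  assume "\<not> thesis"
  then have "x \<notin> diff_points \<Omega> F" if "dist x0 x < d" for x
    using that \<open>\<And>x. x \<in> diff_points \<Omega> F \<Longrightarrow> dist x0 x < d \<Longrightarrow> thesis\<close> by blast
  then have "\<Omega> \<inter> ball x0 d \<subseteq> {x \<in> \<Omega>. \<not> (strictly_differentiable_at \<Omega> F x \<and> F differentiable (at x))}"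
    by (auto simp: diff_points_def)
  then have "negligible (\<Omega> \<inter> ball x0 d)"
    by (rule negligible_subset[OF semismooth_strictly_differentiable_ae[OF assms(1,2)]])
  moreover have "x0 \<in> \<Omega> \<inter> ball x0 d" using assms by simp
  ultimately show False
    using open_not_negligible[of "\<Omega> \<inter> ball x0 d"] assms(1) by blast
qed

text \<open>Jacobians along a sequence of differentiability points tending to \<open>x0\<close> are
  bounded, so a subsequence converges.\<close>

lemma B_jacobian_nonempty:
  assumes "open \<Omega>" "semismooth_on \<Omega> F \<Psi>" "x0 \<in> \<Omega>"
  shows "B_jacobian \<Omega> F x0 \<noteq> {}"
proof -
  obtain d C where d: "d > 0" and
    C: "\<And>x. x \<in> diff_points \<Omega> F \<Longrightarrow> dist x0 x < d \<Longrightarrow> norm (jacobian F (at x)) \<le> C"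
    using jacobian_locally_bounded[OF assms] by metis
  \<comment> \<open>The factor \<open>d\<close> keeps the whole sequence within \<open>d\<close> of
    \<open>x0\<close>, where the bound \<open>C\<close> holds.\<close>
  have "\<exists>x. x \<in> diff_points \<Omega> F \<and> dist x0 x < d * inverse (real (Suc k))" for k
    using diff_points_dense[OF assms, of "d * inverse (real (Suc k))"] d by auto
  then obtain X where X: "\<And>k. X k \<in> diff_points \<Omega> F" "\<And>k. dist x0 (X k) < d * inverse (real (Suc k))"
    by metis
  have "(\<lambda>k. dist (X k) x0) \<longlonglongrightarrow> 0"
  proof (rule Lim_null_comparison)
    show "\<forall>\<^sub>F k in sequentially. norm (dist (X k) x0) \<le> d * inverse (real (Suc k))"
      using X(2) by (simp add: dist_commute less_imp_le)
    show "(\<lambda>k. d * inverse (real (Suc k))) \<longlonglongrightarrow> 0"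
      by (rule tendsto_mult_right_zero[OF LIMSEQ_inverse_real_of_nat])
  qed
  then have lim: "X \<longlonglongrightarrow> x0"
    by (simp add: tendsto_dist_iff[of X])
  have "dist x0 (X k) < d" for k
  proof (rule less_le_trans[OF X(2)])
    show "d * inverse (real (Suc k)) \<le> d"
      using d by (simp add: field_simps)
  qed
  then have "bounded (range (\<lambda>k. jacobian F (at (X k))))"
    unfolding bounded_iff using C X(1) by blast
  then obtain A r where "strict_mono r" "((\<lambda>k. jacobian F (at (X k))) \<circ> r) \<longlonglongrightarrow> A"
    using bounded_imp_convergent_subsequence by blast
  then have "A \<in> B_jacobian \<Omega> F x0"
    using X(1) LIMSEQ_subseq_LIMSEQ[OF lim, of r] unfolding B_jacobian_def o_def
    by (auto intro!: exI[of _ "\<lambda>k. X (r k)"])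
  then show ?thesis by blast
qed

text \<open>The Jacobian is close to \<open>B\<close> only in a prescribed direction, so
  \<open>x - x0\<close> is prescribed. The auxiliary point then lies beyond \<open>x\<close> on the
  ray from \<open>x0\<close>, and the estimate for \<open>B\<close> at \<open>x0\<close> concerns
  the same direction.\<close>

lemma semismooth_jacobian:
  fixes F :: "real^'n \<Rightarrow> real^'m"
  assumes "open \<Omega>" and ss: "semismooth_on \<Omega> F \<Psi>" and "x0 \<in> \<Omega>" "e > 0"
  obtains d where "d > 0" "\<And>x. x \<in> diff_points \<Omega> F \<Longrightarrow> dist x x0 < d \<Longrightarrow>
    norm (F x - F x0 - jacobian F (at x) *v (x - x0)) \<le> e * norm (x - x0)"
proof -
  have "semismooth_at \<Omega> F \<Psi> x0" "e / 2 > 0"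
    using ss \<open>x0 \<in> \<Omega>\<close> \<open>e > 0\<close> by (auto simp: semismooth_on_def)
  then obtain d where d: "d > 0" "\<And>x B. x \<in> \<Omega> \<Longrightarrow> dist x x0 < d \<Longrightarrow> B \<in> \<Psi> x \<Longrightarrow>
      norm (F x - F x0 - B *v (x - x0)) \<le> e / 2 * norm (x - x0)"
    by (rule semismooth_at_estimate) blast
  show thesis
  proof (rule that[OF d(1)])
    fix x assume x: "x \<in> diff_points \<Omega> F" "dist x x0 < d"
    define u where "u = x - x0"
    let ?J = "jacobian F (at x)"
    have pos: "norm u + 1 > 0" by (simp add: add_nonneg_pos)
    \<comment> \<open>The bound 1/3 keeps the final factor \<open>3/4 + 5/8 * t\<close> below 1; the
      other bound keeps the auxiliary point within \<open>d\<close> of \<open>x0\<close>.\<close>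
    define \<delta> where "\<delta> = min (1/3) ((d - norm u) / (norm u + 1))"
    have "\<delta> > 0" using x(2) pos by (simp add: \<delta>_def u_def dist_norm)
    obtain t B where t: "0 < t" "t < \<delta>" and y: "x + t *\<^sub>R u \<in> \<Omega>" and B: "B \<in> \<Psi> (x + t *\<^sub>R u)"
      and 1: "norm (F (x + t *\<^sub>R u) - F x - t *\<^sub>R (B *v u)) \<le> e / 8 * t * norm u"
      and 2: "norm ((B - ?J) *v u) \<le> 2 * (e / 8) * norm u"
      using jacobian_approx[OF assms(1) ss x(1) _ \<open>\<delta> > 0\<close>, of "e/8" u] \<open>e > 0\<close> by auto
    have yx0: "x + t *\<^sub>R u - x0 = (1 + t) *\<^sub>R u"
      by (simp add: u_def algebra_simps)
    have nyx0: "norm ((1 + t) *\<^sub>R u) = (1 + t) * norm u"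
      using t by simp
    have "t * norm u \<le> (d - norm u) / (norm u + 1) * norm u"
      using t(2) by (intro mult_right_mono) (auto simp: \<delta>_def)
    also have "\<dots> < d - norm u"
      unfolding times_divide_eq_left pos_divide_less_eq[OF pos]
      using x(2) by (simp add: algebra_simps u_def dist_norm)
    finally have "dist (x + t *\<^sub>R u) x0 < d"
      by (simp only: dist_norm yx0 nyx0 distrib_right)
    then have 3: "norm (F (x + t *\<^sub>R u) - F x0 - B *v ((1 + t) *\<^sub>R u)) \<le> e / 2 * ((1 + t) * norm u)"
      using d(2)[OF y _ B] by (simp only: yx0 nyx0)
    have "F x - F x0 - ?J *v u = (F (x + t *\<^sub>R u) - F x0 - B *v ((1 + t) *\<^sub>R u))
        - (F (x + t *\<^sub>R u) - F x - t *\<^sub>R (B *v u)) + (B - ?J) *v u"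
      by (simp add: algebra_simps matrix_vector_mult_scaleR)
    also have "norm \<dots> \<le> e / 2 * ((1 + t) * norm u) + e / 8 * t * norm u + 2 * (e / 8) * norm u"
      by (intro norm_triangle_mono norm_triangle_le_diff add_mono 1 2 3)
    also have "\<dots> = (3/4 + 5/8 * t) * (e * norm u)"
      by (simp add: algebra_simps)
    also have "\<dots> \<le> 1 * (e * norm u)"
      using t \<open>e > 0\<close> by (intro mult_right_mono) (auto simp: \<delta>_def)
    finally show "norm (F x - F x0 - ?J *v (x - x0)) \<le> e * norm (x - x0)"
      by (simp add: u_def)
  qed
qed

text \<open>The norm bound and the estimate both pass from Jacobians to their limits, and each
  describes a convex set of matrices, so the hull inherits them.\<close>

lemma semismooth_conv_B_jacobian:
  fixes F :: "real^'n \<Rightarrow> real^'m"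
  assumes "open \<Omega>" and ss: "semismooth_on \<Omega> F \<Psi>"
  shows "semismooth_on \<Omega> F (conv_B_jacobian \<Omega> F)"
  unfolding semismooth_on_def
proof
  fix x0 assume x0: "x0 \<in> \<Omega>"
  show "semismooth_at \<Omega> F (conv_B_jacobian \<Omega> F) x0"
  proof (rule semismooth_atI)
    have "\<Omega> \<subseteq> mdom (conv_B_jacobian \<Omega> F)"
      using B_jacobian_nonempty[OF assms] by (auto simp: mdom_def conv_B_jacobian_def)
    then show "x0 \<in> interior (mdom (conv_B_jacobian \<Omega> F))"
      using interior_maximal[OF _ assms(1)] x0 by blast
  next
    obtain d C where d: "d > 0" "C \<ge> 0" and
      C: "\<And>x. x \<in> diff_points \<Omega> F \<Longrightarrow> dist x0 x < d \<Longrightarrow> norm (jacobian F (at x)) \<le> C"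
      using jacobian_locally_bounded[OF assms x0] by metis
    have "norm A \<le> C" if x: "x \<in> ball x0 d" and A: "A \<in> conv_B_jacobian \<Omega> F x" for x A
    proof -
      have "B_jacobian \<Omega> F x \<subseteq> cball 0 C"
      proof
        fix B assume "B \<in> B_jacobian \<Omega> F x"
        then obtain X where X: "\<And>k. X k \<in> diff_points \<Omega> F" "X \<longlonglongrightarrow> x"
          "(\<lambda>k. jacobian F (at (X k))) \<longlonglongrightarrow> B"
          unfolding B_jacobian_def by blast
        have "\<forall>\<^sub>F k in sequentially. X k \<in> ball x0 d"
          using topological_tendstoD[OF X(2)] x by blast
        then have "\<forall>\<^sub>F k in sequentially. norm (jacobian F (at (X k))) \<le> C"
          by (rule eventually_mono) (use C X(1) in auto)
        then show "B \<in> cball 0 C"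
          using Lim_norm_ubound[OF _ X(3)] by simp
      qed
      then have "convex hull (B_jacobian \<Omega> F x) \<subseteq> cball 0 C"
        by (rule hull_minimal) simp
      then show ?thesis
        using A by (auto simp: conv_B_jacobian_def split: if_splits)
    qed
    then show "locally_bounded_at (conv_B_jacobian \<Omega> F) x0"
      unfolding locally_bounded_at_def using d by (intro exI[of _ "ball x0 d"] exI[of _ C]) auto
  next
    fix e :: real assume "e > 0"
    obtain d where d: "d > 0" "\<And>x. x \<in> diff_points \<Omega> F \<Longrightarrow> dist x x0 < d \<Longrightarrow>
        norm (F x - F x0 - jacobian F (at x) *v (x - x0)) \<le> e * norm (x - x0)"
      using semismooth_jacobian[OF assms x0 \<open>e > 0\<close>] by metis
    have "norm (F x - F x0 - A *v (x - x0)) \<le> e * norm (x - x0)"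
      if x: "x \<in> \<Omega>" "dist x x0 < d" and A: "A \<in> conv_B_jacobian \<Omega> F x" for x A
    proof -
      \<comment> \<open>The matrices satisfying the estimate at \<open>x\<close>: a linear preimage
        of a ball, hence convex.\<close>
      let ?C = "(\<lambda>A. A *v (x - x0)) -` cball (F x - F x0) (e * norm (x - x0))"
      have "B_jacobian \<Omega> F x \<subseteq> ?C"
      proof
        fix B assume "B \<in> B_jacobian \<Omega> F x"
        then obtain X where X: "\<And>k. X k \<in> diff_points \<Omega> F" "X \<longlonglongrightarrow> x"
          "(\<lambda>k. jacobian F (at (X k))) \<longlonglongrightarrow> B"
          unfolding B_jacobian_def by blast
        \<comment> \<open>Supplies the continuity of \<open>F\<close> at \<open>x\<close> for the
          passage to the limit.\<close>
        have "lipschitz_near \<Omega> F x"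
          using semismooth_imp_locally_lipschitz[OF assms] x(1) by (simp add: locally_lipschitz_on_def)
        then obtain U L where "open U" "x \<in> U" "L-lipschitz_on U F"
          unfolding lipschitz_near_def by blast
        then have "isCont F x"
          using lipschitz_on_continuous_on continuous_on_eq_continuous_at by blast
        then have FX: "(\<lambda>k. F (X k)) \<longlonglongrightarrow> F x"
          using X(2) by (rule isCont_tendsto_compose)
        have "(\<lambda>k. jacobian F (at (X k)) *v (X k - x0)) \<longlonglongrightarrow> B *v (x - x0)"
          by (intro vec_tendstoI) (simp only: matrix_vector_mul_component,
            intro tendsto_inner tendsto_vec_nth X(2,3) tendsto_diff tendsto_const)
        then have lim: "(\<lambda>k. norm (F (X k) - F x0 - jacobian F (at (X k)) *v (X k - x0)))
            \<longlonglongrightarrow> norm (F x - F x0 - B *v (x - x0))"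
          by (intro tendsto_norm tendsto_diff FX tendsto_const)
        have rhs: "(\<lambda>k. e * norm (X k - x0)) \<longlonglongrightarrow> e * norm (x - x0)"
          by (intro tendsto_intros X(2))
        have "\<forall>\<^sub>F k in sequentially. X k \<in> ball x0 d"
          using topological_tendstoD[OF X(2) open_ball] x(2) by (metis dist_commute mem_ball)
        then have "\<forall>\<^sub>F k in sequentially.
            norm (F (X k) - F x0 - jacobian F (at (X k)) *v (X k - x0)) \<le> e * norm (X k - x0)"
          by (rule eventually_mono) (use d(2) X(1) in \<open>auto simp: dist_commute\<close>)
        then have "norm (F x - F x0 - B *v (x - x0)) \<le> e * norm (x - x0)"
          by (intro tendsto_le[OF _ rhs lim]) auto
        then show "B \<in> ?C"
          by (simp add: dist_norm)
      qed
      moreover have "convex ?C"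
        by (intro convex_linear_vimage linearI convex_cball)
          (simp_all add: matrix_vector_mult_add_rdistrib scaleR_matrix_vector_assoc)
      ultimately have "convex hull (B_jacobian \<Omega> F x) \<subseteq> ?C"
        by (rule hull_minimal)
      then have "A \<in> ?C"
        using A x(1) by (auto simp: conv_B_jacobian_def)
      then show ?thesis
        by (simp add: dist_norm)
    qed
    then show "\<exists>d>0. \<forall>x\<in>\<Omega>. dist x x0 < d \<longrightarrow> (\<forall>A\<in>conv_B_jacobian \<Omega> F x.
        norm (F x - F x0 - A *v (x - x0)) \<le> e * norm (x - x0))"
      using d(1) by blast
  qed
qed

section \<open>Equivalence and the null exceptional set\<close>

theorem corollary3p9:
  fixes F :: "real^'n \<Rightarrow> real^'m" and \<Omega> :: "(real^'n) set"
  assumes "open \<Omega>"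
  shows "((\<exists>\<Psi> :: real^'n \<Rightarrow> (real^'n^'m) set. semismooth_on \<Omega> F \<Psi>) \<longleftrightarrow>
            locally_lipschitz_on \<Omega> F \<and> semismooth_on \<Omega> F (conv_B_jacobian \<Omega> F)) \<and>
         ((\<exists>\<Psi> :: real^'n \<Rightarrow> (real^'n^'m) set. semismooth_on \<Omega> F \<Psi>) \<longrightarrow>
            {x \<in> \<Omega>. \<not> strictly_differentiable_at \<Omega> F x} \<in> null_sets lebesgue)"
proof (intro conjI iffI impI; (elim exE conjE)?)
  fix \<Psi> :: "real^'n \<Rightarrow> (real^'n^'m) set"
  assume ss: "semismooth_on \<Omega> F \<Psi>"
  show "locally_lipschitz_on \<Omega> F"
    by (rule semismooth_imp_locally_lipschitz[OF assms ss])
  show "semismooth_on \<Omega> F (conv_B_jacobian \<Omega> F)"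
    by (rule semismooth_conv_B_jacobian[OF assms ss])
  have "negligible {x \<in> \<Omega>. \<not> strictly_differentiable_at \<Omega> F x}"
    by (rule negligible_subset[OF semismooth_strictly_differentiable_ae[OF assms ss]]) auto
  then show "{x \<in> \<Omega>. \<not> strictly_differentiable_at \<Omega> F x} \<in> null_sets lebesgue"
    by (simp add: negligible_iff_null_sets)
\<comment> \<open>For the converse, the convexified B-Jacobian itself is the witness for
  \<Psi>.\<close>
qed blast

end
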